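(* For every nonnegative integer $n$: let $LG_2(n)$ denote the number of partitions of $n$ into parts at least $2$ in which any two consecutive parts differ by at least $2$, and by at least $4$ if both are odd. Let $LG_{-2}(n)$ denote the number of signed partitions of $n$ in which the positive parts are odd and each at least $2\ell^+$, and the negative parts are odd, distinct and each at most $2\ell^+$. Let $LG'_{-2}(n)$ denote the number of signed partitions of $n$ in which the positive parts are at least $3$, odd and differ pairwise by at least $4$, and the negative parts are odd, distinct and each at most $2\ell^+-1$. Here $\ell^+$ is the number of positive parts of the signed partition. Then $LG_2(n)=LG_{-2}(n)=LG'_{-2}(n)$ for all $n\ge 0$.
   Context: A partition of an integer $n$ is a finite nonincreasing sequence of positive integers (its parts) summing to $n$. A signed partition of an integer $n$ is a pair $(\pi,\nu)$ of ordinary partitions with $|\pi|-|\nu|=n$, where $|\cdot|$ denotes the sum of parts; the parts of $\pi$ are the positive parts and the parts of $\nu$ are the negative parts (their sizes). $\ell^+$ denotes the number of positive parts of a signed partition. *)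

theory Defs
  imports Main
begin

definition is_partition :: "nat list \<Rightarrow> bool" where
  "is_partition xs \<longleftrightarrow> sorted_wrt (\<ge>) xs \<and> (\<forall>x\<in>set xs. 0 < x)"

definition partitions_of :: "nat \<Rightarrow> nat list set" where
  "partitions_of n = {xs. is_partition xs \<and> sum_list xs = n}"

text \<open>The second component lists the sizes of the negative parts, so its entries are positive.\<close>

definition signed_partitions_of :: "int \<Rightarrow> (nat list \<times> nat list) set" where
  "signed_partitions_of n =
    {(\<pi>, \<nu>). is_partition \<pi> \<and> is_partition \<nu> \<and> int (sum_list \<pi>) - int (sum_list \<nu>) = n}"

definition LG2 :: "nat \<Rightarrow> nat" where
  "LG2 n = card {xs \<in> partitions_of n.
     (\<forall>x\<in>set xs. 2 \<le> x) \<and>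
     (\<forall>i. Suc i < length xs \<longrightarrow>
        xs ! Suc i + 2 \<le> xs ! i \<and>
        (odd (xs ! i) \<and> odd (xs ! Suc i) \<longrightarrow> xs ! Suc i + 4 \<le> xs ! i))}"

definition LG_minus2 :: "nat \<Rightarrow> nat" where
  "LG_minus2 n = card {(\<pi>, \<nu>) \<in> signed_partitions_of (int n).
     (\<forall>x\<in>set \<pi>. odd x \<and> 2 * length \<pi> \<le> x) \<and>
     (\<forall>y\<in>set \<nu>. odd y \<and> y \<le> 2 * length \<pi>) \<and> distinct \<nu>}"

text \<open>The bound on the negative parts is stated over the integers, where
  \<open>2 * length \<pi> - 1\<close> does not truncate for empty \<open>\<pi>\<close>.\<close>

definition LG_minus2' :: "nat \<Rightarrow> nat" where
  "LG_minus2' n = card {(\<pi>, \<nu>) \<in> signed_partitions_of (int n).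
     (\<forall>x\<in>set \<pi>. odd x \<and> 3 \<le> x) \<and> sorted_wrt (\<lambda>x y. y + 4 \<le> x) \<pi> \<and>
     (\<forall>y\<in>set \<nu>. odd y \<and> int y \<le> 2 * int (length \<pi>) - 1) \<and> distinct \<nu>}"

end

theory Submission
  imports Defs
begin

text \<open>Each of the three families arises by adding weakly decreasing lists of \<open>k\<close> even numbers
  entrywise to certain minimal lists.  The partitions counted by \<open>LG2\<close> with parities \<open>bs\<close> lie
  above the smallest such partition, in which \<open>2 + [x odd] + [y odd]\<close> separates consecutive
  parts \<open>x\<close> and \<open>y\<close>; the positive parts of the signed partitions lie above the constant
  list \<open>2k + 1\<close>, respectively above \<open>4k - 1, \<dots>, 7, 3\<close>, both of sum \<open>k (2k + 1)\<close>.
  The negative parts are the numbers \<open>2i + 1\<close> at the indices \<open>i < k\<close> of the even parts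
  (the largest part has index \<open>0\<close>).  They make up the difference: their sum and that of the
  smallest partition with parities \<open>bs\<close> also add up to \<open>k (2k + 1)\<close>.\<close>

subsection \<open>Adding even lists to a fixed list\<close>

definition even_lists :: "nat \<Rightarrow> nat list set" where
  "even_lists k = {ls. length ls = k \<and> sorted_wrt (\<ge>) ls \<and> (\<forall>l\<in>set ls. even l)}"

definition even_above :: "nat list \<Rightarrow> nat list set" where
  "even_above ms = (\<lambda>ls. map2 (+) ls ms) ` even_lists (length ms)"

lemma even_lists_Cons:
  "l # ls \<in> even_lists (Suc k) \<longleftrightarrow> even l \<and> (ls = [] \<or> hd ls \<le> l) \<and> ls \<in> even_lists k"
  by (cases ls) (auto simp: even_lists_def)

lemma length_even_above: "xs \<in> even_above ms \<Longrightarrow> length xs = length ms"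
  by (auto simp: even_above_def even_lists_def)

lemma Nil_in_even_above: "[] \<in> even_above []"
  by (simp add: even_above_def even_lists_def)

lemma even_above_Cons:
  "x # xs \<in> even_above (m # ms) \<longleftrightarrow>
    xs \<in> even_above ms \<and> m \<le> x \<and> (even x \<longleftrightarrow> even m) \<and> (xs = [] \<or> hd xs + m \<le> x + hd ms)"
  (is "?lhs \<longleftrightarrow> ?rhs")
proof
  assume ?lhs
  then obtain l ls where l_ls: "l # ls \<in> even_lists (Suc (length ms))" "x = l + m"
    and xs: "xs = map2 (+) ls ms"
    by (auto simp: even_above_def even_lists_def length_Suc_conv)
  then have "xs \<in> even_above ms"
    by (simp add: even_above_def even_lists_Cons)
  with l_ls show ?rhs
    unfolding xs by (cases ls; cases ms) (auto simp: even_lists_Cons)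
next
  assume rhs: ?rhs
  then obtain ls where ls: "ls \<in> even_lists (length ms)" "xs = map2 (+) ls ms"
    by (auto simp: even_above_def)
  have "(x - m) # ls \<in> even_lists (Suc (length ms))"
    using rhs ls by (cases ls; cases ms) (auto simp: even_lists_Cons even_lists_def)
  then show ?lhs
    using rhs ls by (force simp: even_above_def)
qed

lemma map_odd_even_above: "xs \<in> even_above ms \<Longrightarrow> map odd xs = map odd ms"
proof (induction ms arbitrary: xs)
  case (Cons m ms)
  then show ?case by (cases xs) (auto simp: even_above_Cons dest: length_even_above)
qed (auto dest: length_even_above)

lemma map2_plus_right_cancel:
  fixes xs ys zs :: "'a::cancel_semigroup_add list"
  assumes "length xs = length zs" "length zs = length ys" "map2 (+) xs zs = map2 (+) ys zs"
  shows "xs = ys"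
  using assms by (induction xs zs ys rule: list_induct3) auto

lemma sum_list_map2_plus:
  fixes xs ys :: "'a::comm_monoid_add list"
  assumes "length xs = length ys"
  shows "sum_list (map2 (+) xs ys) = sum_list xs + sum_list ys"
  using assms by (induction xs ys rule: list_induct2) (auto simp: ac_simps)

lemma card_even_above:
  assumes len: "\<And>bs. length (m bs) = length bs"
  shows "card {(bs, xs). xs \<in> even_above (m bs) \<and> P bs (sum_list xs)} =
    card {(bs, ls). ls \<in> even_lists (length bs) \<and> P bs (sum_list ls + sum_list (m bs))}"
    (is "card ?X = card ?L")
proof (rule bij_betw_same_card[symmetric], rule bij_betw_imageI)
  let ?f = "\<lambda>(bs, ls). (bs, map2 (+) ls (m bs))"
  show "inj_on ?f ?L"
    by (auto simp: inj_on_def even_lists_def len intro: map2_plus_right_cancel[rotated 2])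
  have "sum_list (map2 (+) ls (m bs)) = sum_list ls + sum_list (m bs)"
    if "ls \<in> even_lists (length bs)" for ls bs
    using that by (simp add: even_lists_def len sum_list_map2_plus)
  then show "?f ` ?L = ?X"
    by (force simp: even_above_def len)
qed

subsection \<open>Staircases\<close>

definition staircase :: "nat \<Rightarrow> nat \<Rightarrow> nat \<Rightarrow> nat list" where
  "staircase c d k = map (\<lambda>i. c + d * i) (rev [0..<k])"

lemma staircase_0 [simp]: "staircase c d 0 = []"
  and staircase_Suc [simp]: "staircase c d (Suc k) = (c + d * k) # staircase c d k"
  by (simp_all add: staircase_def)

lemma length_staircase [simp]: "length (staircase c d k) = k"
  by (simp add: staircase_def)

lemma sum_list_staircase: "2 * sum_list (staircase c d k) + d * k = k * (2 * c + d * k)"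
  by (induction k) (auto simp: algebra_simps)

lemma even_above_staircase_iff:
  assumes "even d"
  shows "xs \<in> even_above (staircase c d (length xs)) \<longleftrightarrow>
    sorted_wrt (\<lambda>x y. y + d \<le> x) xs \<and> (\<forall>x\<in>set xs. c \<le> x \<and> (even x \<longleftrightarrow> even c))"
proof (induction xs)
  case (Cons x xs)
  show ?case
  proof (cases xs)
    case Nil
    then show ?thesis by (simp add: even_above_Cons Nil_in_even_above)
  next
    case (Cons y ys)
    have "transp (\<lambda>x y. y + d \<le> x)"
      by (auto intro: transpI)
    then have "sorted_wrt (\<lambda>x y. y + d \<le> x) (x # xs) \<longleftrightarrow>
        y + d \<le> x \<and> sorted_wrt (\<lambda>x y. y + d \<le> x) xs"
      unfolding Cons by (rule sorted_wrt2)
    moreover have "x # xs \<in> even_above (staircase c d (length (x # xs))) \<longleftrightarrow>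
        xs \<in> even_above (staircase c d (length xs)) \<and> c + d * length xs \<le> x \<and>
        (even x \<longleftrightarrow> even c) \<and> y + d \<le> x"
      using assms by (simp add: even_above_Cons Cons)
    moreover have "c + d * length ys \<le> y" if "xs \<in> even_above (staircase c d (length xs))"
      using that by (simp add: Cons even_above_Cons)
    ultimately show ?thesis
      using Cons.IH by (auto simp: Cons)
  qed
qed (simp add: Nil_in_even_above)

subsection \<open>Gap partitions\<close>

definition gap_partitions :: "nat list set" where
  "gap_partitions = {xs. (\<forall>x\<in>set xs. 2 \<le> x) \<and>
     successively (\<lambda>x y. y + 2 \<le> x \<and> (odd x \<and> odd y \<longrightarrow> y + 4 \<le> x)) xs}"

lemma gap_iff_add_parities:
  fixes x y :: nat
  shows "y + 2 \<le> x \<and> (odd x \<and> odd y \<longrightarrow> y + 4 \<le> x) \<longleftrightarrow>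
    y + 2 + of_bool (odd x) + of_bool (odd y) \<le> x"
  by (cases "x = y + 2") auto

fun least_gap_partition :: "bool list \<Rightarrow> nat list" where
  "least_gap_partition [] = []"
| "least_gap_partition (b # bs) =
    (2 * Suc (length bs) + of_bool b + 2 * count_list bs True) # least_gap_partition bs"

lemma length_least_gap_partition [simp]: "length (least_gap_partition bs) = length bs"
  by (induction bs) auto

lemma map_odd_least_gap_partition: "map odd (least_gap_partition bs) = bs"
  by (induction bs) auto

lemma even_above_least_gap_partition_iff:
  "xs \<in> even_above (least_gap_partition bs) \<longleftrightarrow> xs \<in> gap_partitions \<and> map odd xs = bs"
proof -
  have "xs \<in> even_above (least_gap_partition (map odd xs)) \<longleftrightarrow> xs \<in> gap_partitions"
  proof (induction xs)
    case (Cons x xs)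
    show ?case
    proof (cases xs)
      case Nil
      then show ?thesis
        by (cases "x = 2") (auto simp: even_above_Cons Nil_in_even_above gap_partitions_def)
    next
      case (Cons y ys)
      have "hd (least_gap_partition (map odd xs)) \<le> y"
        if "xs \<in> even_above (least_gap_partition (map odd xs))"
        using that by (simp add: Cons even_above_Cons)
      moreover have "hd (least_gap_partition (map odd (x # xs))) =
          hd (least_gap_partition (map odd xs)) + 2 + of_bool (odd x) + of_bool (odd y)"
        by (simp add: Cons)
      moreover have "x # xs \<in> gap_partitions \<longleftrightarrow> xs \<in> gap_partitions \<and>
          y + 2 + of_bool (odd x) + of_bool (odd y) \<le> x"
        unfolding gap_partitions_def gap_iff_add_parities by (auto simp: Cons)
      ultimately show ?thesis
        using Cons.IH by (auto simp: even_above_Cons Cons)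
    qed
  qed (simp add: Nil_in_even_above gap_partitions_def)
  then show ?thesis
    using map_odd_even_above map_odd_least_gap_partition by metis
qed

subsection \<open>Distinct odd numbers\<close>

definition distinct_odd_lists :: "nat \<Rightarrow> nat list set" where
  "distinct_odd_lists k = {\<nu>. sorted_wrt (>) \<nu> \<and> (\<forall>y\<in>set \<nu>. odd y \<and> y < 2 * k)}"

definition odds_at_False :: "bool list \<Rightarrow> nat list" where
  "odds_at_False bs = rev (map (\<lambda>i. 2 * i + 1) (filter (\<lambda>i. \<not> bs ! i) [0..<length bs]))"

lemma set_odds_at_False: "set (odds_at_False bs) = {2 * i + 1 |i. i < length bs \<and> \<not> bs ! i}"
  by (auto simp: odds_at_False_def)

lemma odds_at_False_Cons:
  "odds_at_False (b # bs) = map (\<lambda>y. y + 2) (odds_at_False bs) @ (if b then [] else [1])"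
  by (simp add: odds_at_False_def upt_conv_Cons filter_map rev_map o_def
      del: upt_Suc flip: map_Suc_upt)

lemma odds_at_False_in: "odds_at_False bs \<in> distinct_odd_lists (length bs)"
  by (auto simp: distinct_odd_lists_def odds_at_False_def sorted_wrt_rev sorted_wrt_map
      sorted_wrt_filter)

lemma bij_betw_odds_at_False:
  "bij_betw odds_at_False {bs. length bs = k} (distinct_odd_lists k)"
proof (rule bij_betw_byWitness[where f' = "\<lambda>\<nu>. map (\<lambda>i. 2 * i + 1 \<notin> set \<nu>) [0..<k]"])
  show "\<forall>bs\<in>{bs. length bs = k}. map (\<lambda>i. 2 * i + 1 \<notin> set (odds_at_False bs)) [0..<k] = bs"
    by (auto simp: set_odds_at_False intro: nth_equalityI)
  show "\<forall>\<nu>\<in>distinct_odd_lists k. odds_at_False (map (\<lambda>i. 2 * i + 1 \<notin> set \<nu>) [0..<k]) = \<nu>"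
  proof
    fix \<nu> assume \<nu>: "\<nu> \<in> distinct_odd_lists k"
    let ?bs = "map (\<lambda>i. 2 * i + 1 \<notin> set \<nu>) [0..<k]"
    have "set (odds_at_False ?bs) = set \<nu>"
      using \<nu> by (auto simp: set_odds_at_False distinct_odd_lists_def elim!: oddE)
    then have "rev (odds_at_False ?bs) = rev \<nu>"
      using \<nu> odds_at_False_in[of ?bs]
      by (intro strict_sorted_equal) (auto simp: distinct_odd_lists_def sorted_wrt_rev)
    then show "odds_at_False ?bs = \<nu>" by simp
  qed
qed (use odds_at_False_in in auto)

lemma length_odds_at_False: "length (odds_at_False bs) + count_list bs True = length bs"
  by (induction bs) (auto simp: odds_at_False_def[of "[]"] odds_at_False_Cons)

lemma sum_list_least_gap_partition:
  "sum_list (least_gap_partition bs) + sum_list (odds_at_False bs) =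
    length bs * (2 * length bs + 1)"
proof (induction bs)
  case Nil
  show ?case by (simp add: odds_at_False_def)
next
  case (Cons b bs)
  have "sum_list (odds_at_False (b # bs)) =
      sum_list (odds_at_False bs) + 2 * length (odds_at_False bs) + of_bool (\<not> b)"
    by (simp add: odds_at_False_Cons sum_list_Suc)
  with Cons length_odds_at_False[of bs] show ?case by (simp add: algebra_simps)
qed

subsection \<open>Counting by parities and even lists\<close>

definition marked_even_lists :: "nat \<Rightarrow> (bool list \<times> nat list) set" where
  "marked_even_lists n =
    {(bs, ls). ls \<in> even_lists (length bs) \<and> sum_list ls + sum_list (least_gap_partition bs) = n}"

lemma card_gap_partitions:
  "card {xs \<in> gap_partitions. sum_list xs = n} = card (marked_even_lists n)"
proof -
  have "bij_betw (\<lambda>xs. (map odd xs, xs)) {xs \<in> gap_partitions. sum_list xs = n}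
      {(bs, xs). xs \<in> even_above (least_gap_partition bs) \<and> sum_list xs = n}"
    by (rule bij_betw_byWitness[where f' = snd]) (auto simp: even_above_least_gap_partition_iff)
  then have "card {xs \<in> gap_partitions. sum_list xs = n} =
      card {(bs, xs). xs \<in> even_above (least_gap_partition bs) \<and> sum_list xs = n}"
    by (rule bij_betw_same_card)
  also have "\<dots> = card (marked_even_lists n)"
    unfolding marked_even_lists_def by (rule card_even_above) simp
  finally show ?thesis .
qed

definition signed_above :: "(nat \<Rightarrow> nat list) \<Rightarrow> nat \<Rightarrow> (nat list \<times> nat list) set" where
  "signed_above m n = {(\<pi>, \<nu>). \<pi> \<in> even_above (m (length \<pi>)) \<and>
     \<nu> \<in> distinct_odd_lists (length \<pi>) \<and> sum_list \<pi> = n + sum_list \<nu>}"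

lemma bij_betw_signed_above:
  assumes len: "\<And>k. length (m k) = k"
  shows "bij_betw (\<lambda>(bs, \<pi>). (\<pi>, odds_at_False bs))
    {(bs, \<pi>). \<pi> \<in> even_above (m (length bs)) \<and> sum_list \<pi> = n + sum_list (odds_at_False bs)}
    (signed_above m n)" (is "bij_betw ?f ?S ?T")
proof (rule bij_betw_imageI)
  show "inj_on ?f ?S"
  proof (rule inj_onI, safe)
    fix as bs \<pi>
    assume "\<pi> \<in> even_above (m (length as))" "\<pi> \<in> even_above (m (length bs))"
      and eq: "odds_at_False as = odds_at_False bs"
    then have "length as = length bs"
      using length_even_above by (metis len)
    then show "as = bs"
      using inj_onD[OF bij_betw_imp_inj_on[OF bij_betw_odds_at_False[of "length bs"]] eq] by simp
  qed
  show "?f ` ?S = ?T"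
  proof
    show "?f ` ?S \<subseteq> ?T"
    proof clarify
      fix bs \<pi>
      assume above: "\<pi> \<in> even_above (m (length bs))"
        "sum_list \<pi> = n + sum_list (odds_at_False bs)"
      then have "length \<pi> = length bs"
        using length_even_above[of \<pi> "m (length bs)"] by (simp add: len)
      with above show "(\<pi>, odds_at_False bs) \<in> ?T"
        using odds_at_False_in[of bs] by (simp add: signed_above_def)
    qed
    show "?T \<subseteq> ?f ` ?S"
    proof clarify
      fix \<pi> \<nu> assume signed: "(\<pi>, \<nu>) \<in> ?T"
      then have "\<nu> \<in> odds_at_False ` {bs. length bs = length \<pi>}"
        by (simp add: signed_above_def bij_betw_imp_surj_on[OF bij_betw_odds_at_False])
      then obtain bs where "length bs = length \<pi>" "odds_at_False bs = \<nu>"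
        by blast
      with signed show "(\<pi>, \<nu>) \<in> ?f ` ?S"
        by (intro image_eqI[of _ _ "(bs, \<pi>)"]) (auto simp: signed_above_def)
    qed
  qed
qed

lemma card_signed_above:
  assumes len: "\<And>k. length (m k) = k" and sum: "\<And>k. sum_list (m k) = k * (2 * k + 1)"
  shows "card (signed_above m n) = card (marked_even_lists n)"
proof -
  have weight: "sum_list ls + sum_list (m (length bs)) = n + sum_list (odds_at_False bs) \<longleftrightarrow>
      sum_list ls + sum_list (least_gap_partition bs) = n" for bs ls
    unfolding sum using sum_list_least_gap_partition[of bs] by linarith
  have "card (signed_above m n) = card {(bs, \<pi>). \<pi> \<in> even_above (m (length bs)) \<and>
      sum_list \<pi> = n + sum_list (odds_at_False bs)}"
    using bij_betw_signed_above[OF len] by (rule bij_betw_same_card[symmetric])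
  also have "\<dots> = card {(bs, ls). ls \<in> even_lists (length bs) \<and>
      sum_list ls + sum_list (m (length bs)) = n + sum_list (odds_at_False bs)}"
    by (rule card_even_above) (simp add: len)
  also have "\<dots> = card (marked_even_lists n)"
    by (simp add: weight marked_even_lists_def)
  finally show ?thesis .
qed

subsection \<open>The three counts\<close>

lemma is_partition_odd:
  "\<forall>x\<in>set xs. odd x \<Longrightarrow> is_partition xs \<longleftrightarrow> sorted_wrt (\<ge>) xs"
  by (auto simp: is_partition_def intro: odd_pos)

lemma distinct_odd_lists_iff:
  "\<nu> \<in> distinct_odd_lists k \<longleftrightarrow>
    is_partition \<nu> \<and> (\<forall>y\<in>set \<nu>. odd y \<and> y \<le> 2 * k) \<and> distinct \<nu>"
proof -
  have "odd y \<and> y < 2 * k \<longleftrightarrow> odd y \<and> y \<le> 2 * k" for y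
    by (cases "y = 2 * k") auto
  moreover have "sorted_wrt (>) \<nu> \<longleftrightarrow> sorted_wrt (\<ge>) \<nu> \<and> distinct \<nu>"
    using strict_sorted_iff[of "rev \<nu>"] by (simp add: sorted_wrt_rev)
  ultimately show ?thesis
    using is_partition_odd[of \<nu>] by (auto simp: distinct_odd_lists_def)
qed

lemma even_above_staircase_odd_iff:
  assumes "even d" "odd c"
  shows "\<pi> \<in> even_above (staircase c d (length \<pi>)) \<longleftrightarrow>
    is_partition \<pi> \<and> (\<forall>x\<in>set \<pi>. odd x \<and> c \<le> x) \<and> sorted_wrt (\<lambda>x y. y + d \<le> x) \<pi>"
proof -
  have "sorted_wrt (\<ge>) \<pi>" if "sorted_wrt (\<lambda>x y. y + d \<le> x) \<pi>"
    using that by (rule sorted_wrt_mono_rel[rotated]) simp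
  then show ?thesis
    using assms is_partition_odd[of \<pi>] by (auto simp: even_above_staircase_iff)
qed

lemma signed_partitions_of_int_iff:
  "(\<pi>, \<nu>) \<in> signed_partitions_of (int n) \<longleftrightarrow>
    is_partition \<pi> \<and> is_partition \<nu> \<and> sum_list \<pi> = n + sum_list \<nu>"
  by (auto simp: signed_partitions_of_def)

lemma LG2_eq_card: "LG2 n = card (marked_even_lists n)"
proof -
  have "is_partition xs" if "xs \<in> gap_partitions" for xs
  proof -
    have "successively (\<ge>) xs"
      using that unfolding gap_partitions_def
      by (auto elim!: successively_mono)
    then show ?thesis
      using that by (force simp: is_partition_def gap_partitions_def successively_conv_sorted_wrt
          transp_def)
  qed
  then have "LG2 n = card {xs \<in> gap_partitions. sum_list xs = n}"
    unfolding LG2_def partitions_of_def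
    by (intro arg_cong[where f = card]) (auto simp: gap_partitions_def successively_conv_nth)
  then show ?thesis by (simp add: card_gap_partitions)
qed

lemma LG_minus2_eq_card: "LG_minus2 n = card (marked_even_lists n)"
proof -
  have "odd x \<and> 2 * k \<le> x \<longleftrightarrow> odd x \<and> 2 * k + 1 \<le> x" for x k :: nat
    by (cases "x = 2 * k") auto
  moreover have "is_partition \<pi> \<Longrightarrow> sorted_wrt (\<ge>) \<pi>" for \<pi>
    by (simp add: is_partition_def)
  ultimately have "LG_minus2 n = card (signed_above (\<lambda>k. staircase (2 * k + 1) 0 k) n)"
    unfolding LG_minus2_def signed_above_def
    by (intro arg_cong[where f = card])
      (auto simp: signed_partitions_of_int_iff distinct_odd_lists_iff even_above_staircase_odd_iff)
  also have "\<dots> = card (marked_even_lists n)"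
  proof (rule card_signed_above)
    show "sum_list (staircase (2 * k + 1) 0 k) = k * (2 * k + 1)" for k
      using sum_list_staircase[of "2 * k + 1" 0 k] by simp
  qed simp
  finally show ?thesis .
qed

lemma LG_minus2'_eq_card: "LG_minus2' n = card (marked_even_lists n)"
proof -
  have "odd y \<and> int y \<le> 2 * int k - 1 \<longleftrightarrow> odd y \<and> y \<le> 2 * k" for y k
    by (cases "y = 2 * k") auto
  then have "LG_minus2' n = card (signed_above (staircase 3 4) n)"
    unfolding LG_minus2'_def signed_above_def
    by (intro arg_cong[where f = card])
      (auto simp: signed_partitions_of_int_iff distinct_odd_lists_iff even_above_staircase_odd_iff)
  also have "\<dots> = card (marked_even_lists n)"
  proof (rule card_signed_above)
    show "sum_list (staircase 3 4 k) = k * (2 * k + 1)" for k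
      using sum_list_staircase[of 3 4 k] by (simp add: algebra_simps)
  qed simp
  finally show ?thesis .
qed

theorem theorem5p5:
  fixes n :: nat
  shows "LG2 n = LG_minus2 n \<and> LG_minus2 n = LG_minus2' n"
  by (simp add: LG2_eq_card LG_minus2_eq_card LG_minus2'_eq_card)

end
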